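(* Let $P$ be a dcpo and let $H_{c}(P)$ be its consistent Hoare powerdomain. Then the family $\Gamma_{0}(P) = \Gamma(P) \cup \{\emptyset\}$ of all Scott closed subsets of $P$, ordered by inclusion, is order isomorphic to $\Gamma_{F}(H_{c}(P))$, the family of all $F$-Scott closed subsets of $H_{c}(P)$ ordered by inclusion.
   Context: A subset of a poset is consistent if it has an upper bound. A dcpo-$\vee_{\uparrow}$-semilattice is a dcpo in which every consistent pair of elements has a join. A homomorphism of dcpo-$\vee_{\uparrow}$-semilattices is a Scott continuous map preserving joins of consistent pairs. A subset of a dcpo is Scott closed if it is a lower set closed under suprema of directed subsets; $\Gamma(P)$ is the set of nonempty Scott closed subsets of $P$. The consistent Hoare powerdomain $H_{c}(P)$ of a dcpo $P$ is the free dcpo-$\vee_{\uparrow}$-semilattice over $P$: a dcpo-$\vee_{\uparrow}$-semilattice with a Scott continuous map $j : P \to H_c(P)$ such that for every Scott continuous $f : P \to L$ into a dcpo-$\vee_{\uparrow}$-semilattice $L$ there is a unique homomorphism $\tilde f : H_c(P) \to L$ with $f = \tilde f \circ j$. (It can be realized as $\overline{\Gamma_{c}(P)}$, the Scott closure in $\Gamma(P)$ of the family of nonempty consistent Scott closed subsets of $P$, ordered by inclusion, with $j(x) = \downarrow x$ and joins of consistent pairs given by union.) A subset $A$ of a dcpo-$\vee_{\uparrow}$-semilattice $L$ is $F$-Scott closed if it is Scott closed and $\bigvee F \in A$ for every nonempty finite consistent $F \subseteq A$. *)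

theory Defs
  imports "HOL-Algebra.Order" "HOL-Library.FuncSet"
begin

definition directed :: "'a gorder \<Rightarrow> 'a set \<Rightarrow> bool" where
  "directed L D \<longleftrightarrow>
     D \<subseteq> carrier L \<and> D \<noteq> {} \<and> (\<forall>x\<in>D. \<forall>y\<in>D. \<exists>z\<in>D. x \<sqsubseteq>\<^bsub>L\<^esub> z \<and> y \<sqsubseteq>\<^bsub>L\<^esub> z)"

definition consistent :: "'a gorder \<Rightarrow> 'a set \<Rightarrow> bool" where
  "consistent L A \<longleftrightarrow> A \<subseteq> carrier L \<and> Upper L A \<noteq> {}"

text \<open>A dcpo need not have a least element and may be empty.\<close>

locale dcpo = partial_order L for L :: "'a gorder" (structure) +
  assumes directed_sup_exists: "directed L D \<Longrightarrow> \<exists>s. is_lub L s D"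

locale dcpo_consistent_join = dcpo L for L :: "'a gorder" (structure) +
  assumes consistent_join_exists: "consistent L {x, y} \<Longrightarrow> \<exists>s. is_lub L s {x, y}"

definition scott_continuous :: "'a gorder \<Rightarrow> 'b gorder \<Rightarrow> ('a \<Rightarrow> 'b) \<Rightarrow> bool" where
  "scott_continuous P Q f \<longleftrightarrow>
     f \<in> carrier P \<rightarrow> carrier Q \<and>
     (\<forall>x\<in>carrier P. \<forall>y\<in>carrier P. x \<sqsubseteq>\<^bsub>P\<^esub> y \<longrightarrow> f x \<sqsubseteq>\<^bsub>Q\<^esub> f y) \<and>
     (\<forall>D s. directed P D \<longrightarrow> is_lub P s D \<longrightarrow> is_lub Q (f s) (f ` D))"

definition consistent_join_hom :: "'a gorder \<Rightarrow> 'b gorder \<Rightarrow> ('a \<Rightarrow> 'b) \<Rightarrow> bool" where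
  "consistent_join_hom L M g \<longleftrightarrow>
     scott_continuous L M g \<and>
     (\<forall>x y s. consistent L {x, y} \<longrightarrow> is_lub L s {x, y} \<longrightarrow> is_lub M (g s) {g x, g y})"

text \<open>
  The universal property of \<open>j\<close> with respect to all targets whose carrier lies in the type \<open>'l\<close>.
  Functions out of \<open>H\<close> are compared on \<open>carrier H\<close> only, hence \<^const>\<open>extensional\<close>.
\<close>

definition universal_for ::
  "'l itself \<Rightarrow> 'a gorder \<Rightarrow> 'h gorder \<Rightarrow> ('a \<Rightarrow> 'h) \<Rightarrow> bool" where
  "universal_for (T :: 'l itself) P H j \<longleftrightarrow>
     (\<forall>(L :: 'l gorder) f. dcpo_consistent_join L \<longrightarrow> scott_continuous P L f \<longrightarrow>
        (\<exists>!g. g \<in> extensional (carrier H) \<and> consistent_join_hom H L g \<and>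
              (\<forall>x\<in>carrier P. f x = g (j x))))"

text \<open>
  \<open>j : P \<rightarrow> H\<close> is the free dcpo with consistent joins over the dcpo \<open>P\<close>. A formula cannot quantify
  over the types of the targets; it is enough to test targets in the types \<open>'a set\<close> and \<open>'h\<close>.
  The standard model \<open>R\<close> (the Scott closure, inside the nonempty Scott closed subsets of \<open>P\<close>, of
  the consistent ones) lives in \<open>'a set\<close> and is universal for every type of targets. So the first
  instance yields a homomorphism \<open>H \<rightarrow> R\<close>, universality of \<open>R\<close> yields one \<open>R \<rightarrow> H\<close>, and they are
  mutually inverse by uniqueness for \<open>R\<close> and, via the second instance, for \<open>H\<close>. Hence the
  predicate holds exactly of the copies of \<open>R\<close>, which are universal for all targets of all types.
\<close>

definition consistent_hoare_powerdomain ::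
  "'a gorder \<Rightarrow> 'h gorder \<Rightarrow> ('a \<Rightarrow> 'h) \<Rightarrow> bool" where
  "consistent_hoare_powerdomain P H j \<longleftrightarrow>
     dcpo_consistent_join H \<and> scott_continuous P H j \<and>
     universal_for TYPE('a set) P H j \<and> universal_for TYPE('h) P H j"

definition scott_closed :: "'a gorder \<Rightarrow> 'a set \<Rightarrow> bool" where
  "scott_closed P A \<longleftrightarrow>
     A \<subseteq> carrier P \<and>
     (\<forall>x\<in>A. \<forall>y\<in>carrier P. y \<sqsubseteq>\<^bsub>P\<^esub> x \<longrightarrow> y \<in> A) \<and>
     (\<forall>D s. directed P D \<longrightarrow> D \<subseteq> A \<longrightarrow> is_lub P s D \<longrightarrow> s \<in> A)"

definition F_scott_closed :: "'a gorder \<Rightarrow> 'a set \<Rightarrow> bool" where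
  "F_scott_closed L A \<longleftrightarrow>
     scott_closed L A \<and>
     (\<forall>F s. finite F \<longrightarrow> F \<noteq> {} \<longrightarrow> F \<subseteq> A \<longrightarrow> consistent L F \<longrightarrow> is_lub L s F \<longrightarrow> s \<in> A)"

definition Gamma :: "'a gorder \<Rightarrow> 'a set set" where
  "Gamma P = {A. scott_closed P A \<and> A \<noteq> {}}"

definition Gamma_0 :: "'a gorder \<Rightarrow> 'a set set" where
  "Gamma_0 P = Gamma P \<union> {{}}"

text \<open>The empty set is an element of this family.\<close>

definition Gamma_F :: "'a gorder \<Rightarrow> 'a set set" where
  "Gamma_F L = {A. F_scott_closed L A}"

definition inclusion_order :: "'a set set \<Rightarrow> 'a set gorder" where
  "inclusion_order \<A> = \<lparr>carrier = \<A>, eq = (=), le = (\<subseteq>)\<rparr>"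

definition order_isomorphic :: "'a gorder \<Rightarrow> 'b gorder \<Rightarrow> bool" where
  "order_isomorphic X Y \<longleftrightarrow>
     (\<exists>\<phi>. bij_betw \<phi> (carrier X) (carrier Y) \<and>
          (\<forall>x\<in>carrier X. \<forall>y\<in>carrier X. x \<sqsubseteq>\<^bsub>X\<^esub> y \<longleftrightarrow> \<phi> x \<sqsubseteq>\<^bsub>Y\<^esub> \<phi> y))"

end

theory Submission
  imports Defs
begin

text \<open>
  Scott closed sets of \<open>P\<close> are the zero sets of Scott continuous maps from \<open>P\<close> into the two-element
  chain, and \<open>F\<close>-Scott closed sets of \<open>H\<close> are the zero sets of homomorphisms from \<open>H\<close> into it. By
  universality at this one target, \<open>B \<mapsto> j\<^sup>-\<^sup>1(B)\<close> is therefore a bijection. It preserves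
  intersections, so it also reflects inclusion.
\<close>

section \<open>Suprema in families of sets and the two-element chain\<close>

lemma inclusion_order_simps [simp]:
  "carrier (inclusion_order \<A>) = \<A>"
  "le (inclusion_order \<A>) = (\<subseteq>)"
  "eq (inclusion_order \<A>) = (=)"
  by (simp_all add: inclusion_order_def)

lemma partial_order_inclusion_order: "partial_order (inclusion_order \<A>)"
  by unfold_locales auto

text \<open>In a family not closed under unions a supremum may be strictly larger than the union;
  the second assumption rules this out.\<close>

lemma is_lub_inclusion_order_iff:
  assumes "X \<subseteq> \<A>" "\<Union>X \<in> \<A>"
  shows "is_lub (inclusion_order \<A>) s X \<longleftrightarrow> s = \<Union>X"
proof
  assume "is_lub (inclusion_order \<A>) s X"
  then show "s = \<Union>X"
    using assms by (auto simp: least_def Upper_def)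
next
  assume "s = \<Union>X"
  then show "is_lub (inclusion_order \<A>) s X"
    using assms by (auto simp: least_def Upper_def)
qed

text \<open>The two-element chain is realized inside \<open>'a set\<close>, a type at which universality is assumed.\<close>

definition two :: "'a set gorder" where
  "two = inclusion_order {{}, UNIV}"

text \<open>Members of \<open>A\<close> go to the bottom element because a Scott closed set is a
  lower set: with this orientation the map is monotone and \<open>A\<close> is its zero set.\<close>

definition char_map :: "'b set \<Rightarrow> 'b \<Rightarrow> 'a set" where
  "char_map A x = (if x \<in> A then {} else UNIV)"

lemma two_simps [simp]: "carrier two = {{}, UNIV}" "le two = (\<subseteq>)"
  by (simp_all add: two_def)

lemma is_lub_two_iff: "X \<subseteq> {{}, UNIV} \<Longrightarrow> is_lub two s X \<longleftrightarrow> s = \<Union>X"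
  unfolding two_def by (rule is_lub_inclusion_order_iff) auto

lemma dcpo_consistent_join_two: "dcpo_consistent_join two"
proof -
  interpret partial_order two
    unfolding two_def by (rule partial_order_inclusion_order)
  \<comment> \<open>The union of any subset of the chain is its supremum, which covers directed sets
    and consistent pairs alike.\<close>
  have "\<exists>s. is_lub two s X" if "X \<subseteq> carrier two" for X :: "'a set set"
    using that by (simp add: is_lub_two_iff)
  then show ?thesis
    by unfold_locales (simp_all only: directed_def consistent_def)
qed

lemma char_map_eq_empty_iff [simp]: "char_map A x = {} \<longleftrightarrow> x \<in> A"
  by (simp add: char_map_def)

text \<open>The union of the values is bottom exactly when all of \<open>X\<close> lies in
  \<open>A\<close>. Preservation of suprema thus becomes a membership condition on
  \<open>A\<close>.\<close>

lemma is_lub_char_map_iff: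
  "is_lub two (char_map A s :: 'a set) (char_map A ` X) \<longleftrightarrow> (s \<in> A \<longleftrightarrow> X \<subseteq> A)"
proof -
  have "\<Union>(char_map A ` X :: 'a set set) = (if X \<subseteq> A then {} else UNIV)"
    by (auto simp: char_map_def split: if_splits)
  moreover have "(char_map A ` X :: 'a set set) \<subseteq> {{}, UNIV}"
    by (auto simp: char_map_def)
  ultimately have "is_lub two (char_map A s :: 'a set) (char_map A ` X) \<longleftrightarrow>
      (char_map A s :: 'a set) = (if X \<subseteq> A then {} else UNIV)"
    by (simp only: is_lub_two_iff)
  then show ?thesis
    by (simp add: char_map_def)
qed

section \<open>Characteristic maps of closed sets\<close>

lemma is_lub_upper: "is_lub L s X \<Longrightarrow> x \<in> X \<Longrightarrow> X \<subseteq> carrier L \<Longrightarrow> x \<sqsubseteq>\<^bsub>L\<^esub> s"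
  by (auto simp: least_def Upper_def)

lemma is_lub_carrier: "is_lub L s X \<Longrightarrow> s \<in> carrier L"
  by (auto simp: least_def Upper_def)

lemma scott_closed_lower:
  "scott_closed P A \<Longrightarrow> x \<in> A \<Longrightarrow> y \<in> carrier P \<Longrightarrow> y \<sqsubseteq>\<^bsub>P\<^esub> x \<Longrightarrow> y \<in> A"
  by (auto simp: scott_closed_def)

lemma scott_closed_directed_sup:
  "scott_closed P A \<Longrightarrow> directed P D \<Longrightarrow> D \<subseteq> A \<Longrightarrow> is_lub P s D \<Longrightarrow> s \<in> A"
  by (auto simp: scott_closed_def)

lemma scott_closed_is_lubD:
  assumes "scott_closed P A" "X \<subseteq> carrier P" "is_lub P s X" "s \<in> A"
  shows "X \<subseteq> A"
  using assms is_lub_upper[OF assms(3)] by (blast intro: scott_closed_lower)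

lemma scott_continuous_char_map:
  assumes "scott_closed P A"
  shows "scott_continuous P two (char_map A)"
  unfolding scott_continuous_def
proof (intro conjI ballI allI impI)
  show "char_map A \<in> carrier P \<rightarrow> carrier two"
    by (simp add: char_map_def)
next
  fix x y
  assume "x \<in> carrier P" "y \<in> carrier P" "x \<sqsubseteq>\<^bsub>P\<^esub> y"
  then show "char_map A x \<sqsubseteq>\<^bsub>two\<^esub> char_map A y"
    using scott_closed_lower[OF assms] by (auto simp: char_map_def)
next
  fix D s
  assume D: "directed P D" "is_lub P s D"
  then have "D \<subseteq> carrier P"
    by (simp add: directed_def)
  with D show "is_lub two (char_map A s) (char_map A ` D)"
    using scott_closed_directed_sup[OF assms] scott_closed_is_lubD[OF assms]
    unfolding is_lub_char_map_iff by metis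
qed

text \<open>Being a lower set gives one direction of the membership condition for
  \<open>{x, y}\<close>; closure under finite consistent joins gives the other.\<close>

lemma consistent_join_hom_char_map:
  assumes "F_scott_closed L B"
  shows "consistent_join_hom L two (char_map B)"
proof -
  have closed: "scott_closed L B"
    using assms by (simp add: F_scott_closed_def)
  have "is_lub two (char_map B s) {char_map B x, char_map B y}"
    if "consistent L {x, y}" "is_lub L s {x, y}" for x y s
  proof -
    have "s \<in> B \<longleftrightarrow> {x, y} \<subseteq> B"
    proof
      assume "s \<in> B"
      moreover have "{x, y} \<subseteq> carrier L"
        using that by (simp add: consistent_def)
      ultimately show "{x, y} \<subseteq> B"
        using scott_closed_is_lubD[OF closed] that by blast
    next
      assume "{x, y} \<subseteq> B"
      moreover have "finite {x, y}" "{x, y} \<noteq> {}"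
        by auto
      ultimately show "s \<in> B"
        using assms that unfolding F_scott_closed_def by blast
    qed
    then show ?thesis
      using is_lub_char_map_iff[of B s "{x, y}"] by simp
  qed
  then show ?thesis
    using scott_continuous_char_map[OF closed] unfolding consistent_join_hom_def by blast
qed

section \<open>Preimages and zero sets of homomorphisms\<close>

lemma scott_closed_vimage:
  assumes "scott_continuous P Q f" "scott_closed Q B"
  shows "scott_closed P {x \<in> carrier P. f x \<in> B}"
proof -
  have mono: "f x \<sqsubseteq>\<^bsub>Q\<^esub> f y" if "x \<in> carrier P" "y \<in> carrier P" "x \<sqsubseteq>\<^bsub>P\<^esub> y" for x y
    using assms(1) that by (auto simp: scott_continuous_def)
  have carr: "f x \<in> carrier Q" if "x \<in> carrier P" for x
    using assms(1) that by (auto simp: scott_continuous_def)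
  have "f s \<in> B" if D: "directed P D" "D \<subseteq> {x \<in> carrier P. f x \<in> B}" "is_lub P s D" for D s
  proof (rule scott_closed_directed_sup[OF assms(2)])
    show "is_lub Q (f s) (f ` D)"
      using assms(1) D by (simp add: scott_continuous_def)
    show "f ` D \<subseteq> B"
      using D by auto
    \<comment> \<open>A monotone map sends directed sets to directed sets.\<close>
    have "\<exists>z\<in>D. f x \<sqsubseteq>\<^bsub>Q\<^esub> f z \<and> f y \<sqsubseteq>\<^bsub>Q\<^esub> f z" if xy: "x \<in> D" "y \<in> D" for x y
    proof -
      obtain z where "z \<in> D" "x \<sqsubseteq>\<^bsub>P\<^esub> z" "y \<sqsubseteq>\<^bsub>P\<^esub> z"
        using D(1) xy unfolding directed_def by blast
      moreover from this have "x \<in> carrier P" "y \<in> carrier P" "z \<in> carrier P"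
        using D(1) xy by (auto simp: directed_def)
      ultimately show ?thesis
        using mono by blast
    qed
    then show "directed Q (f ` D)"
      using D(1) carr by (auto simp: directed_def)
  qed
  then show ?thesis
    using mono carr scott_closed_lower[OF assms(2)]
    unfolding scott_closed_def by (auto dest: is_lub_carrier)
qed

text \<open>Homomorphisms control only binary joins, whereas \<open>F_scott_closed\<close> concerns
  all nonempty finite consistent sets. Induction bridges the gap: the join of
  \<open>insert x F\<close> is that of \<open>x\<close> with the join of \<open>F\<close>.\<close>

lemma (in dcpo_consistent_join) finite_consistent_lub_mem:
  assumes binary: "\<And>x y s. x \<in> A \<Longrightarrow> y \<in> A \<Longrightarrow> consistent L {x, y} \<Longrightarrow> is_lub L s {x, y} \<Longrightarrow> s \<in> A"
    and "finite F" "F \<noteq> {}" "F \<subseteq> A" "consistent L F"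
  shows "\<exists>s\<in>A. is_lub L s F"
  using assms(2-)
proof (induction rule: finite_ne_induct)
  case (singleton x)
  then have "is_lub L x {x}"
    by (auto simp: least_def Upper_def consistent_def)
  then show ?case
    using singleton by auto
next
  case (insert x F)
  obtain u where u: "u \<in> Upper L (insert x F)"
    using insert.prems by (auto simp: consistent_def)
  have carr: "x \<in> carrier L" "F \<subseteq> carrier L"
    using insert.prems by (auto simp: consistent_def)
  \<comment> \<open>The bound \<open>u\<close> serves twice: it makes \<open>F\<close> consistent
    for the induction hypothesis and, lying above the join of \<open>F\<close>, later makes
    \<open>{x, t}\<close> consistent.\<close>
  have uF: "u \<in> Upper L F" and xu: "x \<sqsubseteq> u" and u_carr: "u \<in> carrier L"
    using u carr by (auto simp: Upper_def)
  have "consistent L F"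
    using uF carr by (auto simp: consistent_def)
  then obtain t where t: "t \<in> A" "is_lub L t F"
    using insert by auto
  have t_carr: "t \<in> carrier L"
    using t(2) by (rule is_lub_carrier)
  have least_t: "t \<sqsubseteq> v" if "v \<in> Upper L F" for v
    using t(2) that by (auto simp: least_def)
  \<comment> \<open>\<open>is_lub\<close> depends on a set only through its upper bounds, so this
    equality turns a join of the pair into a join of \<open>insert x F\<close>.\<close>
  have upper_eq: "Upper L {x, t} = Upper L (insert x F)"
  proof (intro equalityI subsetI)
    fix v
    assume v: "v \<in> Upper L {x, t}"
    then have "v \<in> carrier L" "x \<sqsubseteq> v" "t \<sqsubseteq> v"
      using carr t_carr by (auto simp: Upper_def)
    moreover have "y \<sqsubseteq> v" if "y \<in> F" for y
      using is_lub_upper[OF t(2) that carr(2)] that \<open>t \<sqsubseteq> v\<close> \<open>v \<in> carrier L\<close> t_carr carr(2)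
      by (meson le_trans subsetD)
    ultimately show "v \<in> Upper L (insert x F)"
      by (auto simp: Upper_def)
  next
    fix v
    assume v: "v \<in> Upper L (insert x F)"
    then have "v \<in> Upper L F" "v \<in> carrier L" "x \<sqsubseteq> v"
      using carr by (auto simp: Upper_def)
    then show "v \<in> Upper L {x, t}"
      using least_t by (auto simp: Upper_def)
  qed
  have cons: "consistent L {x, t}"
    using u upper_eq carr t_carr by (auto simp: consistent_def)
  then obtain s where s: "is_lub L s {x, t}"
    using consistent_join_exists by blast
  have "s \<in> A"
    using binary[OF _ t(1) cons s] insert.prems by auto
  then show ?case
    using s upper_eq by auto
qed

text \<open>A homomorphism sends the join of a consistent pair of zeros to a join of bottoms, which
  is bottom; \<open>finite_consistent_lub_mem\<close> extends this to finite sets.\<close>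

lemma F_scott_closed_zero_set:
  assumes "dcpo_consistent_join L" "consistent_join_hom L two g"
  shows "F_scott_closed L {x \<in> carrier L. g x = {}}"
proof -
  interpret dcpo_consistent_join L by fact
  let ?Z = "{x \<in> carrier L. g x = {}}"
  \<comment> \<open>\<open>{{}}\<close> is the singleton of the bottom element of
    \<open>two\<close>; the zero set is its preimage.\<close>
  have "scott_closed two {{}}"
    unfolding scott_closed_def by (auto simp: directed_def is_lub_two_iff)
  then have closed: "scott_closed L ?Z"
    using scott_closed_vimage[of L two g "{{}}"] assms(2) by (simp add: consistent_join_hom_def)
  have binary: "s \<in> ?Z"
    if "x \<in> ?Z" "y \<in> ?Z" "consistent L {x, y}" "is_lub L s {x, y}" for x y s
  proof -
    have "is_lub two (g s) {g x, g y}"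
      using assms(2) that(3,4) unfolding consistent_join_hom_def by blast
    then have "g s = {}"
      using that by (simp add: is_lub_two_iff)
    then show ?thesis
      using that is_lub_carrier by fastforce
  qed
  have "s \<in> ?Z"
    if F: "finite F" "F \<noteq> {}" "F \<subseteq> ?Z" "consistent L F" and s: "is_lub L s F" for F s
  proof -
    have "\<exists>t\<in>?Z. is_lub L t F"
      by (rule finite_consistent_lub_mem[OF binary F])
    then obtain t where t: "t \<in> ?Z" "is_lub L t F" ..
    \<comment> \<open>Membership is known for some join of \<open>F\<close>; uniqueness transfers it
      to the given one.\<close>
    have "s = t"
      using s t(2) by (rule least_unique)
    with t(1) show ?thesis
      by simp
  qed
  then show ?thesis
    unfolding F_scott_closed_def using closed by blast
qed

section \<open>Intersections and transport along equalities and inverses\<close>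

lemma scott_closed_Int:
  assumes "scott_closed L A" "scott_closed L B"
  shows "scott_closed L (A \<inter> B)"
proof -
  have "A \<inter> B \<subseteq> carrier L"
    using assms(1) by (auto simp: scott_closed_def)
  then show ?thesis
    using scott_closed_lower[OF assms(1)] scott_closed_lower[OF assms(2)]
      scott_closed_directed_sup[OF assms(1)] scott_closed_directed_sup[OF assms(2)]
    unfolding scott_closed_def[of L "A \<inter> B"] by auto
qed

lemma F_scott_closed_Int:
  assumes "F_scott_closed L A" "F_scott_closed L B"
  shows "F_scott_closed L (A \<inter> B)"
  using assms scott_closed_Int unfolding F_scott_closed_def by (metis le_inf_iff IntI)

text \<open>\<open>universal_for\<close> compares extensional maps only, so a characteristic map has
  to be restricted to the carrier. Suprema lie in the carrier, so the restriction keeps their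
  values.\<close>

lemma consistent_join_hom_cong:
  assumes "\<And>x. x \<in> carrier L \<Longrightarrow> g x = h x" and hom: "consistent_join_hom L M g"
  shows "consistent_join_hom L M h"
proof -
  have eq: "h s = g s" "h ` X = g ` X" if "is_lub L s X" "X \<subseteq> carrier L" for s X
    using assms(1) that is_lub_carrier[OF that(1)] by (auto simp: subset_iff image_iff)
  have "is_lub M (h s) (h ` D)" if "directed L D" "is_lub L s D" for D s
    using hom eq[of s D] that
    by (auto simp: consistent_join_hom_def scott_continuous_def directed_def)
  moreover have "is_lub M (h s) {h x, h y}" if "consistent L {x, y}" "is_lub L s {x, y}" for x y s
    using hom eq[of s "{x, y}"] that by (auto simp: consistent_join_hom_def consistent_def)
  ultimately show ?thesis
    using hom assms(1) unfolding consistent_join_hom_def scott_continuous_def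
    by (auto simp: Pi_iff)
qed

text \<open>The preimage map runs from closed sets of \<open>H\<close> to those of \<open>P\<close>,
  opposite to the direction claimed.\<close>

lemma order_isomorphic_sym:
  assumes "order_isomorphic X Y"
  shows "order_isomorphic Y X"
proof -
  obtain \<phi> where \<phi>: "bij_betw \<phi> (carrier X) (carrier Y)"
    "\<And>x y. x \<in> carrier X \<Longrightarrow> y \<in> carrier X \<Longrightarrow> x \<sqsubseteq>\<^bsub>X\<^esub> y \<longleftrightarrow> \<phi> x \<sqsubseteq>\<^bsub>Y\<^esub> \<phi> y"
    using assms by (auto simp: order_isomorphic_def)
  let ?\<psi> = "inv_into (carrier X) \<phi>"
  have bij: "bij_betw ?\<psi> (carrier Y) (carrier X)"
    using \<phi>(1) by (rule bij_betw_inv_into)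
  have "x \<sqsubseteq>\<^bsub>Y\<^esub> y \<longleftrightarrow> ?\<psi> x \<sqsubseteq>\<^bsub>X\<^esub> ?\<psi> y" if "x \<in> carrier Y" "y \<in> carrier Y" for x y
    using \<phi>(2)[of "?\<psi> x" "?\<psi> y"] bij_betw_apply[OF bij] bij_betw_inv_into_right[OF \<phi>(1)] that
    by simp
  with bij show ?thesis
    unfolding order_isomorphic_def by blast
qed

text \<open>The empty set is Scott closed because directed sets are nonempty.\<close>

lemma Gamma_0_eq: "Gamma_0 P = {A. scott_closed P A}"
  by (auto simp: Gamma_0_def Gamma_def scott_closed_def directed_def)

section \<open>The isomorphism given by preimages along the universal map\<close>

theorem theorem3p10:
  fixes P :: "'a gorder" and H :: "'h gorder" and j :: "'a \<Rightarrow> 'h"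
  assumes "dcpo P"
    and "consistent_hoare_powerdomain P H j"
  shows "order_isomorphic (inclusion_order (Gamma_0 P)) (inclusion_order (Gamma_F H))"
proof -
  have H: "dcpo_consistent_join H" and j: "scott_continuous P H j"
    and univ: "universal_for TYPE('a set) P H j"
    using assms(2) by (auto simp: consistent_hoare_powerdomain_def)
  have j_carrier: "j x \<in> carrier H" if "x \<in> carrier P" for x
    using j that by (auto simp: scott_continuous_def)
  define \<phi> where "\<phi> B = {x \<in> carrier P. j x \<in> B}" for B
  have ext: "\<exists>!g :: 'h \<Rightarrow> 'a set. g \<in> extensional (carrier H) \<and> consistent_join_hom H two g \<and>
      (\<forall>x\<in>carrier P. char_map A x = g (j x))" if "scott_closed P A" for A
    using univ[unfolded universal_for_def, rule_format, OF dcpo_consistent_join_two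
        scott_continuous_char_map[OF that]] .
  have closed: "scott_closed P (\<phi> B)" if "F_scott_closed H B" for B
    unfolding \<phi>_def using j that by (intro scott_closed_vimage) (auto simp: F_scott_closed_def)
  have surj: "\<exists>B. F_scott_closed H B \<and> \<phi> B = A" if A: "scott_closed P A" for A
  proof -
    \<comment> \<open>The zero set of the homomorphism extending \<open>char_map A\<close> is the
      required \<open>B\<close>.\<close>
    obtain g :: "'h \<Rightarrow> 'a set"
      where g: "consistent_join_hom H two g" "\<forall>x\<in>carrier P. char_map A x = g (j x)"
      using ext[OF A] by blast
    have "A \<subseteq> carrier P"
      using A by (simp add: scott_closed_def)
    moreover have "g (j x) = {} \<longleftrightarrow> x \<in> A" if "x \<in> carrier P" for x
      using g(2) that by (metis char_map_eq_empty_iff)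
    ultimately have "\<phi> {x \<in> carrier H. g x = {}} = A"
      using j_carrier unfolding \<phi>_def by blast
    then show ?thesis
      using F_scott_closed_zero_set[OF H g(1)] by blast
  qed
  have inj: "B = C" if B: "F_scott_closed H B" and C: "F_scott_closed H C" and eq: "\<phi> B = \<phi> C"
    for B C
  proof -
    let ?r = "\<lambda>B. restrict (char_map B :: 'h \<Rightarrow> 'a set) (carrier H)"
    \<comment> \<open>For \<open>x\<close> in the carrier of \<open>P\<close>, \<open>j x\<close>
      lies in \<open>D\<close> exactly when \<open>x\<close> lies in \<open>\<phi> D\<close>. Hence
      \<open>?r D\<close> is the unique extension of \<open>char_map (\<phi> D)\<close>, and equal
      preimages force equal extensions.\<close>
    have r: "?r D \<in> extensional (carrier H) \<and> consistent_join_hom H two (?r D) \<and>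
        (\<forall>x\<in>carrier P. char_map (\<phi> D) x = ?r D (j x))" if "F_scott_closed H D" for D
      using consistent_join_hom_cong[OF _ consistent_join_hom_char_map[OF that], of "?r D"]
        j_carrier by (auto simp: \<phi>_def char_map_def)
    have "?r B = ?r C"
      using ext[OF closed[OF B]] r[OF B] r[OF C] eq by auto
    then have "x \<in> B \<longleftrightarrow> x \<in> C" if "x \<in> carrier H" for x
      using that by (metis char_map_eq_empty_iff restrict_apply')
    moreover have "B \<subseteq> carrier H" "C \<subseteq> carrier H"
      using B C by (auto simp: F_scott_closed_def scott_closed_def)
    ultimately show ?thesis
      by blast
  qed
  have reflects: "B \<subseteq> C"
    if B: "F_scott_closed H B" and C: "F_scott_closed H C" and "\<phi> B \<subseteq> \<phi> C" for B C
  proof -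
    \<comment> \<open>Preimages commute with intersections, so the inclusion of preimages becomes an
      equality to which injectivity applies.\<close>
    have "\<phi> (B \<inter> C) = \<phi> B"
      using that(3) by (auto simp: \<phi>_def)
    then have "B \<inter> C = B"
      by (rule inj[OF F_scott_closed_Int[OF B C] B])
    then show ?thesis
      by blast
  qed
  have "\<phi> B \<subseteq> \<phi> C" if "B \<subseteq> C" for B C
    using that by (auto simp: \<phi>_def)
  with reflects have "\<forall>B\<in>Gamma_F H. \<forall>C\<in>Gamma_F H. B \<subseteq> C \<longleftrightarrow> \<phi> B \<subseteq> \<phi> C"
    unfolding Gamma_F_def by blast
  moreover have "bij_betw \<phi> (Gamma_F H) (Gamma_0 P)"
    unfolding bij_betw_def inj_on_def Gamma_F_def Gamma_0_eq
    using inj closed surj by (auto simp: image_iff) metis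
  ultimately have "order_isomorphic (inclusion_order (Gamma_F H)) (inclusion_order (Gamma_0 P))"
    unfolding order_isomorphic_def inclusion_order_simps by blast
  then show ?thesis
    by (rule order_isomorphic_sym)
qed

end
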